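(* Let $0<r<\pi/2-\varepsilon$ and let $K:\mathbb S^{k}\times\mathbb S^{k}\to\mathbb R$ have the form $K(x,y)=g(d(x,y)^2)$ for all $x,y\in\mathbb S^k$, where $g:[0,\infty)\to\mathbb R$ is differentiable with locally Lipschitz continuous derivative. Suppose that $g'\ge0$ and that $g'$ is continuously differentiable on $[0,4r^2]$. Define $G(x,y)=2g'(d(x,y)^2)\frac{d(x,y)}{\sin(d(x,y))}$ for $x,y\in\mathcal D_\varepsilon$ with $x\ne y$, and $G(x,x)=2g'(0)$ for $x\in\mathcal D_\varepsilon$. Assume that there is a constant $C>0$ such that $G(x,y)\ge C$ for all $x,y\in\mathcal D_\varepsilon$, and that $G(x_1,y_1)\ge G(x_2,y_2)$ for all $x_1,y_1,x_2,y_2\in\mathcal D_\varepsilon$ such that $d(x_1,y_1)\ge d(x_2,y_2)$. Let $\rho_0\in\mathcal P(\mathcal D_\varepsilon)$ be such that $\operatorname{supp}(\rho_0)\subset\overline D_r$, and let $\rho\in C([0,\infty);\mathcal P(\mathcal D_\varepsilon))$ be the unique global weak solution to the aggregation model $\partial_t\rho-\nabla_{\mathbb S^k}\cdot(\rho\,\nabla_{\mathbb S^k}K*\rho)=0$ on $\mathcal D_\varepsilon$ starting from $\rho_0$. Then there exists $p\in\overline D_r$ such that $W_1(\rho_t,\delta_p)\to0$ as $t\to\infty$.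
   Context: $\mathbb S^k\subset\mathbb R^{k+1}$ is the $k$-dimensional unit sphere with the metric induced from $\mathbb R^{k+1}$; its intrinsic distance is $d(x,y)=\arccos(x\cdot y)\in[0,\pi]$. Points and tangent vectors are regarded as vectors of $\mathbb R^{k+1}$. $N=(0,\dots,0,1)$ is the North pole. Fix $\varepsilon\in(0,\pi/2)$ and set $\mathcal D_\varepsilon=\{x\in\mathbb S^k: d(x,N)<\pi/2-\varepsilon\}$; $\overline D_r=\{x\in\mathbb S^k: d(x,N)\le r\}$. $\mathcal P(\mathcal D_\varepsilon)$ is the set of Borel probability measures on $\mathcal D_\varepsilon$, and $C([0,\infty);\mathcal P(\mathcal D_\varepsilon))$ is the set of curves continuous for the narrow topology. $W_1(\rho,\sigma)=\inf_{\pi\in\Pi(\rho,\sigma)}\int d(x,y)\,d\pi(x,y)$ is the intrinsic 1-Wasserstein distance, $\Pi(\rho,\sigma)$ being the set of couplings of $\rho$ and $\sigma$. For a curve $(\rho_t)\subset\mathcal P(\mathcal D_\varepsilon)$ the velocity field is $v[\rho](x,t)=-\int_{\mathcal D_\varepsilon}\nabla_{\mathbb S^k}K_y(x)\,d\rho_t(y)$, where $K_y(x)=K(x,y)$ and $\nabla_{\mathbb S^k}$ is the manifold gradient in $x$; for $x,y\in\mathcal D_\varepsilon$, $\nabla_{\mathbb S^k}K_y(x)=-2g'(d(x,y)^2)\log_xy$, with $\log_x y=\frac{\theta}{\sin\theta}(y-\cos\theta\,x)$, $\theta=d(x,y)$ (and $\log_xx=0$). Given a time-dependent vector field $X$ on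 $\mathcal D_\varepsilon$ and $\Sigma\subset\mathcal D_\varepsilon$, a flow map generated by $(X,\Sigma)$ on $[0,T)$, $T\in(0,\infty]$, is a map $\Psi_X:\Sigma\times[0,T)\to\mathcal D_\varepsilon$, written $\Psi_X^t(x)$, with $\frac{d}{dt}\Psi_X^t(x)=X(\Psi_X^t(x),t)$ and $\Psi_X^0(x)=x$ for all $x\in\Sigma$, $t\in[0,T)$. A curve $(\rho_t)_{t\in[0,T)}\subset\mathcal P(\mathcal D_\varepsilon)$ is a weak solution if $v[\rho]$ generates a unique flow map $\Psi_{v[\rho]}$ defined on $\operatorname{supp}(\rho_0)\times[0,T)$ and $\rho_t=\Psi^t_{v[\rho]}\#\rho_0$ (push-forward) for all $t\in[0,T)$; it is global if $T=\infty$. Under the hypotheses (with $g'\ge0$ and $\operatorname{supp}(\rho_0)\subset\overline D_r$) the global weak solution in $C([0,\infty);\mathcal P(\mathcal D_\varepsilon))$ exists and is unique, and $\operatorname{supp}(\rho_t)\subset\overline D_r$ for all $t\ge0$. *)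

theory Defs
  imports "HOL-Probability.Probability"
begin

definition sphere_dist :: "'a::euclidean_space \<Rightarrow> 'a \<Rightarrow> real" where
  "sphere_dist x y = arccos (x \<bullet> y)"

text \<open>The Riemannian gradient on the unit sphere of a function that matters only on the sphere.
  The Frechet derivative within the sphere determines \<open>v\<close> on the tangent space at \<open>x\<close>;
  \<open>v \<bullet> x = 0\<close> makes \<open>v\<close> a tangent vector.\<close>

definition sphere_grad :: "('a::euclidean_space \<Rightarrow> real) \<Rightarrow> 'a \<Rightarrow> 'a" where
  "sphere_grad f x =
    (THE v. v \<bullet> x = 0 \<and> (f has_derivative (\<lambda>h. v \<bullet> h)) (at x within sphere 0 1))"

text \<open>The ambient space of the \<open>k\<close>-sphere is modelled as \<open>(real^'k) \<times> real\<close> with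
  \<open>k = CARD('k)\<close>, so that the last coordinate is the second component.\<close>

definition north :: "(real^'k) \<times> real" where
  "north = (0, 1)"

definition open_cap :: "real \<Rightarrow> ((real^'k) \<times> real) set" where
  "open_cap \<epsilon> = {x \<in> sphere 0 1. sphere_dist x north < pi / 2 - \<epsilon>}"

definition closed_cap :: "real \<Rightarrow> ((real^'k) \<times> real) set" where
  "closed_cap r = {x \<in> sphere 0 1. sphere_dist x north \<le> r}"

definition borel_on :: "'a::topological_space set \<Rightarrow> 'a measure" where
  "borel_on X = restrict_space borel X"

definition prob_measures :: "'a::topological_space set \<Rightarrow> 'a measure set" where
  "prob_measures X = {\<mu>. prob_space \<mu> \<and> sets \<mu> = sets (borel_on X)}"

definition supp :: "'a::topological_space measure \<Rightarrow> 'a set" where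
  "supp \<mu> = {x \<in> space \<mu>. \<forall>U. open U \<and> x \<in> U \<longrightarrow> emeasure \<mu> (U \<inter> space \<mu>) > 0}"

definition narrowly_continuous_on ::
    "'a::topological_space set \<Rightarrow> real set \<Rightarrow> (real \<Rightarrow> 'a measure) \<Rightarrow> bool" where
  "narrowly_continuous_on X I \<rho> \<longleftrightarrow>
    (\<forall>\<phi> :: 'a \<Rightarrow> real. continuous_on X \<phi> \<and> bounded (\<phi> ` X)
      \<longrightarrow> continuous_on I (\<lambda>t. \<integral>x. \<phi> x \<partial>\<rho> t))"

definition couplings :: "'a measure \<Rightarrow> 'a measure \<Rightarrow> ('a \<times> 'a) measure set" where
  "couplings \<mu> \<nu> = {\<pi>. prob_space \<pi> \<and> sets \<pi> = sets (\<mu> \<Otimes>\<^sub>M \<nu>)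
      \<and> distr \<pi> \<mu> fst = \<mu> \<and> distr \<pi> \<nu> snd = \<nu>}"

definition W1 :: "'a::euclidean_space measure \<Rightarrow> 'a measure \<Rightarrow> ennreal" where
  "W1 \<mu> \<nu> = (INF \<pi>\<in>couplings \<mu> \<nu>. \<integral>\<^sup>+ p. ennreal (sphere_dist (fst p) (snd p)) \<partial>\<pi>)"

definition velocity ::
    "('a::euclidean_space \<Rightarrow> 'a \<Rightarrow> real) \<Rightarrow> (real \<Rightarrow> 'a measure) \<Rightarrow> 'a \<Rightarrow> real \<Rightarrow> 'a" where
  "velocity K \<rho> x t = - (\<integral>y. sphere_grad (\<lambda>z. K z y) x \<partial>\<rho> t)"

definition time_interval :: "ereal \<Rightarrow> real set" where
  "time_interval T = {t. 0 \<le> t \<and> ereal t < T}"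

definition flow_map ::
    "'a::euclidean_space set \<Rightarrow> ('a \<Rightarrow> real \<Rightarrow> 'a) \<Rightarrow> 'a set \<Rightarrow> ereal \<Rightarrow> (real \<Rightarrow> 'a \<Rightarrow> 'a) \<Rightarrow> bool"
  where
  "flow_map D X S T \<Psi> \<longleftrightarrow>
    (\<forall>x\<in>S. \<Psi> 0 x = x \<and>
      (\<forall>t\<in>time_interval T. \<Psi> t x \<in> D \<and>
        ((\<lambda>s. \<Psi> s x) has_vector_derivative X (\<Psi> t x) t) (at t within time_interval T)))"

definition unique_flow_map ::
    "'a::euclidean_space set \<Rightarrow> ('a \<Rightarrow> real \<Rightarrow> 'a) \<Rightarrow> 'a set \<Rightarrow> ereal \<Rightarrow> (real \<Rightarrow> 'a \<Rightarrow> 'a) \<Rightarrow> bool"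
  where
  "unique_flow_map D X S T \<Psi> \<longleftrightarrow> flow_map D X S T \<Psi> \<and>
    (\<forall>\<Phi>. flow_map D X S T \<Phi> \<longrightarrow> (\<forall>x\<in>S. \<forall>t\<in>time_interval T. \<Phi> t x = \<Psi> t x))"

text \<open>The flow map matters only on \<open>supp (\<rho> 0)\<close>, so the push-forward is taken of the restriction
  of \<open>\<rho> 0\<close> to its support. Since \<open>distr\<close> is meaningful only for measurable maps, the
  measurability implicit in speaking of a push-forward is spelled out.\<close>

definition weak_solution ::
    "'a::euclidean_space set \<Rightarrow> ('a \<Rightarrow> 'a \<Rightarrow> real) \<Rightarrow> ereal \<Rightarrow> (real \<Rightarrow> 'a measure) \<Rightarrow> bool" where
  "weak_solution D K T \<rho> \<longleftrightarrow>
    (\<forall>t\<in>time_interval T. \<rho> t \<in> prob_measures D) \<and>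
    (\<exists>\<Psi>. unique_flow_map D (velocity K \<rho>) (supp (\<rho> 0)) T \<Psi> \<and>
      (\<forall>t\<in>time_interval T.
        \<Psi> t \<in> restrict_space (\<rho> 0) (supp (\<rho> 0)) \<rightarrow>\<^sub>M borel_on D \<and>
        \<rho> t = distr (restrict_space (\<rho> 0) (supp (\<rho> 0))) (borel_on D) (\<Psi> t)))"

definition interaction_G :: "(real \<Rightarrow> real) \<Rightarrow> 'a::euclidean_space \<Rightarrow> 'a \<Rightarrow> real" where
  "interaction_G g' x y =
    (if x = y then 2 * g' 0
     else 2 * g' ((sphere_dist x y)\<^sup>2) * (sphere_dist x y / sin (sphere_dist x y)))"

end

theory Submission
  imports Defs "HOL-Real_Asymp.Real_Asymp"
begin

text \<open>
  The proof follows the mean \<open>m t\<close> of the measure \<open>\<rho> t\<close>, a vector in the closed unit ball. A probability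
  measure on the sphere whose mean is a unit vector \<open>p\<close> is the point mass at \<open>p\<close>, so it is enough to
  show that \<open>m t\<close> converges to a unit vector \<open>p\<close>: then \<open>W1\<close> tends to 0, because the distance
  \<open>arccos (x \<bullet> p)\<close> has upper bounds that are affine in \<open>x \<bullet> p\<close> and whose integrals therefore depend
  only on \<open>m t \<bullet> p\<close> (\<open>W1_return_le_mean\<close>).

  A particle at \<open>x\<close> moves with the average over \<open>y\<close> of the pulls \<open>G x y *\<^sub>R (y - (x \<bullet> y) *\<^sub>R x)\<close>. In the
  derivative of the mean each pair of particles contributes both its pulls, whose sum is
  \<open>(G x y * (1 - x \<bullet> y)) *\<^sub>R (x + y)\<close> (\<open>symmetrized_attraction\<close>). In the cap every such vector points
  upwards, and its length is at most \<open>1 / sin \<epsilon>\<close> times its vertical component. So the same is true of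
  the derivative of \<open>m\<close>: the curve cannot move without gaining height at a proportional rate
  (\<open>mean_velocity_bounds\<close>). The height is at most 1, hence the curve has finite length and
  converges. Moreover \<open>C \<le> G\<close> makes the height grow at rate at least \<open>C * sin \<epsilon> * (1 - m t \<bullet> m t)\<close>,
  so \<open>1 - m t \<bullet> m t\<close> tends to 0 and the limit \<open>p\<close> is a unit vector
  (\<open>mean_converges_to_unit_vector\<close>).

  Finally \<open>p\<close> lies in the closed cap: its height is at least that of \<open>m 0\<close>, which is at
  least \<open>cos r\<close> by the assumption on the initial support.
\<close>

section \<open>The sphere and its caps\<close>

lemma inner_unit_range:
  fixes x y :: "'a::euclidean_space"
  assumes "x \<in> sphere 0 1" "y \<in> sphere 0 1"
  shows "-1 \<le> x \<bullet> y" "x \<bullet> y \<le> 1"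
  using Cauchy_Schwarz_ineq2[of x y] assms by (auto simp: abs_le_iff)

lemma norm_sum_unit:
  fixes x y :: "'a::euclidean_space"
  assumes "x \<in> sphere 0 1" "y \<in> sphere 0 1"
  shows "(norm (x + y))\<^sup>2 = 2 * (1 + x \<bullet> y)" "(norm (x - y))\<^sup>2 = 2 * (1 - x \<bullet> y)"
  using assms
  by (simp_all add: power2_norm_eq_inner inner_add_left inner_add_right inner_diff_left
      inner_diff_right inner_commute[of y x] norm_eq_1)

lemma inner_unit_less_1:
  fixes x y :: "'a::euclidean_space"
  assumes "x \<in> sphere 0 1" "y \<in> sphere 0 1" "x \<noteq> y"
  shows "x \<bullet> y < 1"
proof -
  have "0 < (norm (x - y))\<^sup>2" using assms(3) by simp
  then show ?thesis using norm_sum_unit(2)[OF assms(1,2)] by simp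
qed

lemma inner_unit_greater_minus_1:
  fixes x y :: "'a::euclidean_space"
  assumes "x \<in> sphere 0 1" "y \<in> sphere 0 1" "x + y \<noteq> 0"
  shows "- 1 < x \<bullet> y"
proof -
  have "0 < (norm (x + y))\<^sup>2" using assms(3) by simp
  then show ?thesis using norm_sum_unit(1)[OF assms(1,2)] by simp
qed

lemma height_in_open_cap:
  assumes "0 < \<epsilon>" "\<epsilon> < pi / 2" "x \<in> open_cap \<epsilon>"
  shows "sin \<epsilon> < x \<bullet> north"
proof -
  have x: "x \<in> sphere 0 1" and d: "arccos (x \<bullet> north) < pi / 2 - \<epsilon>"
    using assms(3) by (auto simp: open_cap_def sphere_dist_def)
  have n: "(north :: (real^'a) \<times> real) \<in> sphere 0 1" by (simp add: north_def norm_prod_def)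
  have u: "-1 \<le> x \<bullet> north" "x \<bullet> north \<le> 1" by (rule inner_unit_range[OF x n])+
  have "cos (pi / 2 - \<epsilon>) < cos (arccos (x \<bullet> north))"
    using d u assms by (intro cos_monotone_0_pi arccos_lbound) auto
  then show ?thesis using u by (simp add: cos_diff)
qed

lemma closed_cap_iff_height:
  assumes "0 \<le> r" "r \<le> pi" "x \<in> sphere 0 1"
  shows "x \<in> closed_cap r \<longleftrightarrow> cos r \<le> x \<bullet> north"
proof -
  have n: "(north :: (real^'a) \<times> real) \<in> sphere 0 1" by (simp add: north_def norm_prod_def)
  have u: "-1 \<le> x \<bullet> north" "x \<bullet> north \<le> 1" by (rule inner_unit_range[OF assms(3) n])+
  have "arccos (x \<bullet> north) \<le> arccos (cos r) \<longleftrightarrow> cos r \<le> x \<bullet> north"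
    using u by (intro arccos_le_mono) (auto simp: abs_le_iff)
  then show ?thesis using assms by (simp add: closed_cap_def sphere_dist_def arccos_cos)
qed

lemma closed_cap_subset_open_cap: "r < pi / 2 - \<epsilon> \<Longrightarrow> closed_cap r \<subseteq> open_cap \<epsilon>"
  by (auto simp: closed_cap_def open_cap_def)

section \<open>The gradient of the interaction potential\<close>

text \<open>
  The derivative within the sphere sees every tangent direction, because each of them is the velocity
  of a great circle; so it determines the tangent vector \<open>v\<close>.
\<close>

lemma sphere_grad_eqI:
  fixes f :: "'a::euclidean_space \<Rightarrow> real"
  assumes x: "x \<in> sphere 0 1" and vx: "v \<bullet> x = 0"
    and der: "(f has_derivative (\<lambda>h. v \<bullet> h)) (at x within sphere 0 1)"
  shows "sphere_grad f x = v"
  unfolding sphere_grad_def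
proof (rule the_equality)
  show "v \<bullet> x = 0 \<and> (f has_derivative (\<lambda>h. v \<bullet> h)) (at x within sphere 0 1)"
    using vx der by simp
next
  fix w assume w: "w \<bullet> x = 0 \<and> (f has_derivative (\<lambda>h. w \<bullet> h)) (at x within sphere 0 1)"
  define q where "q = w - v"
  show "w = v"
  proof (rule ccontr)
    assume "w \<noteq> v"
    then have q0: "norm q > 0" by (simp add: q_def)
    have qx: "q \<bullet> x = 0" using w vx by (simp add: q_def inner_diff_left)
    \<comment> \<open>The great circle leaving \<open>x\<close> in the direction of \<open>q\<close> stays on the sphere, so the function
      \<open>f - f\<close> can be differentiated along it: once it gives \<open>norm q\<close>, once it gives 0.\<close>
    define c where "c = (\<lambda>t. cos t *\<^sub>R x + sin t *\<^sub>R (q /\<^sub>R norm q))"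
    have c_sphere: "c t \<in> sphere 0 1" for t
    proof -
      have "(norm (c t))\<^sup>2 = (norm (cos t *\<^sub>R x))\<^sup>2 + (norm (sin t *\<^sub>R (q /\<^sub>R norm q)))\<^sup>2"
        unfolding c_def using qx
        by (intro norm_add_Pythagorean) (simp add: orthogonal_def inner_commute)
      also have "\<dots> = (cos t)\<^sup>2 + (sin t)\<^sup>2"
        using x q0 by (simp add: power_mult_distrib flip: divide_inverse)
      finally show ?thesis by (simp add: abs_square_eq_1 norm_ge_zero power2_eq_1_iff)
    qed
    have c_der: "(c has_vector_derivative (q /\<^sub>R norm q)) (at 0 within UNIV)"
      unfolding c_def by (auto intro!: derivative_eq_intros)
    have zero: "((\<lambda>z. f z - f z) has_derivative (\<lambda>h. w \<bullet> h - v \<bullet> h)) (at (c 0) within c ` UNIV)"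
      using w der c_sphere
      by (intro has_derivative_subset[where s = "sphere 0 1" and t = "c ` UNIV"] has_derivative_diff)
        (auto simp: c_def)
    have "(((\<lambda>z. f z - f z) \<circ> c) has_vector_derivative (w \<bullet> (q /\<^sub>R norm q) - v \<bullet> (q /\<^sub>R norm q)))
        (at 0 within UNIV)"
      using vector_derivative_diff_chain_within[OF c_der zero] by simp
    moreover have "(((\<lambda>z. f z - f z) \<circ> c) has_vector_derivative 0) (at 0 within UNIV)"
      by (simp add: o_def)
    ultimately have "w \<bullet> (q /\<^sub>R norm q) - v \<bullet> (q /\<^sub>R norm q) = 0"
      using vector_derivative_unique_at by fastforce
    then have "q \<bullet> q / norm q = 0"
      by (simp add: q_def inner_diff_left diff_divide_distrib divide_inverse algebra_simps)
    then show False using q0 by simp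
  qed
qed

text \<open>
  The ambient gradient of \<open>z \<mapsto> \<phi> (z \<bullet> y)\<close> is \<open>d *\<^sub>R y\<close>, and the gradient on the sphere is its tangential
  part. The derivative of \<open>\<phi>\<close> is taken within \<open>{-1..1}\<close>, which is one-sided at \<open>x = y\<close>; so the
  lemma covers the squared distance on the diagonal, where \<open>arccos\<close> reaches the end of its domain.
\<close>

lemma sphere_grad_of_inner:
  fixes x y :: "'a::euclidean_space"
  assumes x: "x \<in> sphere 0 1" and y: "y \<in> sphere 0 1"
    and \<phi>: "(\<phi> has_real_derivative d) (at (x \<bullet> y) within {-1..1})"
    and f: "\<And>z. z \<in> sphere 0 1 \<Longrightarrow> f z = \<phi> (z \<bullet> y)"
  shows "sphere_grad f x = d *\<^sub>R (y - (x \<bullet> y) *\<^sub>R x)"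
proof (rule sphere_grad_eqI[OF x])
  have xx: "x \<bullet> x = 1" using x by (simp add: dot_square_norm)
  show "d *\<^sub>R (y - (x \<bullet> y) *\<^sub>R x) \<bullet> x = 0"
    by (simp add: inner_diff_left xx inner_commute[of y x])
  have range: "z \<bullet> y \<in> {-1..1}" if "z \<in> sphere 0 1" for z
    using inner_unit_range[OF that y] by simp
  have 1: "((\<lambda>z. \<phi> (z \<bullet> y)) has_derivative (\<lambda>h. d * (h \<bullet> y))) (at x within sphere 0 1)"
  proof (rule has_derivative_in_compose[of "\<lambda>z. z \<bullet> y" "\<lambda>h. h \<bullet> y" x "sphere 0 1" \<phi> "\<lambda>h. d * h"])
    show "((\<lambda>z. z \<bullet> y) has_derivative (\<lambda>h. h \<bullet> y)) (at x within sphere 0 1)"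
      by (auto intro!: derivative_eq_intros)
    show "(\<phi> has_derivative (*) d) (at (x \<bullet> y) within (\<lambda>z. z \<bullet> y) ` sphere 0 1)"
      using \<phi> range unfolding has_field_derivative_def
      by (rule_tac has_derivative_subset[where s = "{-1..1}"]) auto
  qed
  \<comment> \<open>This function vanishes on the sphere, yet its ambient derivative is the radial one. Subtracting
    a multiple of it removes the radial part of the derivative and leaves the function unchanged on the sphere.\<close>
  have 2: "((\<lambda>z. z \<bullet> x - 1 + (z - x) \<bullet> (z - x) / 2) has_derivative (\<lambda>h. h \<bullet> x)) (at x within sphere 0 1)"
    by (auto intro!: derivative_eq_intros)
  have 3: "((\<lambda>z. \<phi> (z \<bullet> y) - (d * (x \<bullet> y)) * (z \<bullet> x - 1 + (z - x) \<bullet> (z - x) / 2)) has_derivative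
      (\<lambda>h. d * (h \<bullet> y) - (d * (x \<bullet> y)) * (h \<bullet> x))) (at x within sphere 0 1)"
    by (intro has_derivative_diff 1 has_derivative_mult_right 2)
  have "z \<bullet> x - 1 + (z - x) \<bullet> (z - x) / 2 = 0" if "z \<in> sphere 0 1" for z
  proof -
    have "z \<bullet> z = 1" using that by (simp add: dot_square_norm)
    then show ?thesis
      using xx by (simp add: inner_diff_left inner_diff_right inner_commute[of x z] field_simps)
  qed
  then have 4: "(f has_derivative (\<lambda>h. d * (h \<bullet> y) - (d * (x \<bullet> y)) * (h \<bullet> x))) (at x within sphere 0 1)"
    by (intro has_derivative_transform[OF x _ 3]) (simp add: f)
  show "(f has_derivative (\<lambda>h. d *\<^sub>R (y - (x \<bullet> y) *\<^sub>R x) \<bullet> h)) (at x within sphere 0 1)"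
    by (rule has_derivative_eq_rhs[OF 4]) (auto simp: fun_eq_iff inner_diff_left inner_commute algebra_simps)
qed

text \<open>
  With \<open>u = cos \<theta>\<close> the difference quotient is \<open>\<theta>\<^sup>2 / (cos \<theta> - 1)\<close>: squaring cancels the square-root
  singularity of \<open>arccos\<close> at 1.
\<close>

lemma arccos_sq_derivative_at_1:
  "((\<lambda>u. (arccos u)\<^sup>2) has_real_derivative - 2) (at 1 within {-1..1})"
proof -
  have lim: "((\<lambda>\<theta>. \<theta>\<^sup>2 / (cos \<theta> - 1)) \<longlongrightarrow> - 2) (at_right (0::real))"
    by real_asymp
  have "continuous (at 1 within {-1..1}) arccos"
    using continuous_on_arccos' by (auto simp: continuous_on_eq_continuous_within)
  then have "(arccos \<longlongrightarrow> 0) (at 1 within {-1..1})"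
    by (simp add: continuous_within)
  moreover have "\<forall>\<^sub>F u in at 1 within {-1..1}. arccos u \<in> {0<..} \<and> arccos u \<noteq> 0"
  proof (unfold eventually_at_filter, rule always_eventually, intro allI impI)
    fix u :: real assume "u \<noteq> 1" "u \<in> {-1..1}"
    then have "arccos 1 < arccos u" by (intro arccos_less_arccos) auto
    then show "arccos u \<in> {0<..} \<and> arccos u \<noteq> 0" by simp
  qed
  ultimately have "filterlim arccos (at_right 0) (at 1 within {-1..1})"
    unfolding filterlim_at by auto
  from filterlim_compose[OF lim this]
  have "((\<lambda>u. (arccos u)\<^sup>2 / (cos (arccos u) - 1)) \<longlongrightarrow> - 2) (at 1 within {-1..1})" .
  then show ?thesis
    unfolding has_field_derivative_iff
    by (rule Lim_transform_eventually) (auto simp: eventually_at_filter intro!: always_eventually)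
qed

lemma arccos_sq_derivative:
  assumes "-1 < u" "u < 1"
  shows "((\<lambda>u. (arccos u)\<^sup>2) has_real_derivative - 2 * (arccos u / sin (arccos u))) (at u within S)"
proof -
  have "((\<lambda>u. (arccos u)\<^sup>2) has_real_derivative - 2 * (arccos u / sin (arccos u))) (at u)"
    using assms by (auto intro!: derivative_eq_intros simp: sin_arccos divide_inverse)
  then show ?thesis by (rule has_field_derivative_at_within)
qed

definition attraction :: "(real \<Rightarrow> real) \<Rightarrow> 'a::euclidean_space \<Rightarrow> 'a \<Rightarrow> 'a" where
  "attraction g' x y = interaction_G g' x y *\<^sub>R (y - (x \<bullet> y) *\<^sub>R x)"

text \<open>
  The interaction potential is a function of \<open>x \<bullet> y\<close>, namely \<open>g\<close> composed with the square of
  \<open>arccos\<close>, and the derivative of that function is \<open>- interaction_G g' x y\<close>, on the diagonal too.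
\<close>

lemma sphere_grad_interaction:
  fixes x y :: "'a::euclidean_space"
  assumes x: "x \<in> sphere 0 1" and y: "y \<in> sphere 0 1" and xy: "x + y \<noteq> 0"
    and K: "\<And>z. z \<in> sphere 0 1 \<Longrightarrow> f z = g ((sphere_dist z y)\<^sup>2)"
    and g: "\<And>s. 0 \<le> s \<Longrightarrow> (g has_real_derivative g' s) (at s within {0..})"
  shows "sphere_grad f x = - attraction g' x y"
proof -
  let ?u = "x \<bullet> y"
  have u: "- 1 < ?u" "?u \<le> 1"
    using inner_unit_greater_minus_1[OF x y xy] inner_unit_range[OF x y] by auto
  have chain: "(g \<circ> (\<lambda>u. (arccos u)\<^sup>2) has_real_derivative g' ((arccos ?u)\<^sup>2) * d) (at ?u within {-1..1})"
    if "((\<lambda>u. (arccos u)\<^sup>2) has_real_derivative d) (at ?u within {-1..1})" for d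
    using that by (intro DERIV_image_chain DERIV_subset[OF g]) auto
  have "(g \<circ> (\<lambda>u. (arccos u)\<^sup>2) has_real_derivative - interaction_G g' x y) (at ?u within {-1..1})"
  proof (cases "x = y")
    case True
    then have "?u = 1" using y by (simp add: norm_eq_1)
    then show ?thesis
      using chain[of "-2"] arccos_sq_derivative_at_1 True
      by (simp add: interaction_G_def mult.commute)
  next
    case False
    then have "?u < 1" by (rule inner_unit_less_1[OF x y])
    then show ?thesis
      using chain[OF arccos_sq_derivative[of ?u]] u False
      by (simp add: interaction_G_def sphere_dist_def mult_ac)
  qed
  from sphere_grad_of_inner[OF x y this] show ?thesis
    using K by (simp add: attraction_def sphere_dist_def)
qed

section \<open>The attraction between two points\<close>

text \<open>
  The kernel \<open>interaction_G\<close> contains the factor \<open>\<theta> / sin \<theta>\<close>, which blows up near antipodal points, but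
  the tangential part of \<open>y\<close> has length \<open>sin \<theta>\<close>. Hence the attraction has length \<open>2 * \<bar>g' (\<theta>\<^sup>2)\<bar> * \<theta>\<close>.
\<close>

lemma norm_attraction_le:
  fixes x y :: "'a::euclidean_space"
  assumes x: "x \<in> sphere 0 1" and y: "y \<in> sphere 0 1"
    and B: "\<And>s. 0 \<le> s \<Longrightarrow> s \<le> pi\<^sup>2 \<Longrightarrow> \<bar>g' s\<bar> \<le> B"
  shows "norm (attraction g' x y) \<le> 2 * B * pi"
proof -
  let ?\<theta> = "sphere_dist x y"
  have u: "-1 \<le> x \<bullet> y" "x \<bullet> y \<le> 1" by (rule inner_unit_range[OF x y])+
  have \<theta>: "0 \<le> ?\<theta>" "?\<theta> \<le> pi" using u by (auto simp: sphere_dist_def arccos_lbound arccos_ubound)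
  have B0: "0 \<le> B" using B[of 0] by simp
  have xx: "x \<bullet> x = 1" "y \<bullet> y = 1" using x y by (auto simp: norm_eq_1)
  have "(norm (y - (x \<bullet> y) *\<^sub>R x))\<^sup>2 = 1 - (x \<bullet> y)\<^sup>2"
    unfolding power2_norm_eq_inner
    by (simp only: inner_diff_left inner_diff_right inner_scaleR_left inner_scaleR_right xx
        inner_commute[of y x] power2_eq_square) simp
  also have "\<dots> = (sin ?\<theta>)\<^sup>2"
    using u by (simp add: sphere_dist_def sin_squared_eq)
  finally have tangent: "norm (y - (x \<bullet> y) *\<^sub>R x) = sin ?\<theta>"
    using sin_ge_zero[OF \<theta>] by (simp add: power2_eq_iff_nonneg)
  have "?\<theta>\<^sup>2 \<le> pi\<^sup>2" using \<theta> by (intro power_mono) auto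
  then have g': "\<bar>g' (?\<theta>\<^sup>2)\<bar> \<le> B" by (intro B) auto
  show ?thesis
  proof (cases "x = y \<or> sin ?\<theta> = 0")
    case True
    then have "attraction g' x y = 0"
      using tangent xx by (auto simp: attraction_def)
    then show ?thesis using B0 by simp
  next
    case False
    then have "norm (attraction g' x y) = 2 * \<bar>g' (?\<theta>\<^sup>2)\<bar> * ?\<theta>"
      using tangent \<theta> sin_ge_zero[OF \<theta>] by (simp add: attraction_def interaction_G_def abs_mult)
    also have "\<dots> \<le> 2 * B * pi"
      using g' \<theta> B0 by (intro mult_mono) auto
    finally show ?thesis .
  qed
qed

text \<open>
  The key identity: although the pull that \<open>y\<close> exerts on \<open>x\<close> is tangent to the sphere at \<open>x\<close>, and
  conversely, the sum of the two points along \<open>x + y\<close>. For unit vectors and a positive kernel the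
  coefficient is nonnegative and vanishes only if the points agree.
\<close>

lemma symmetrized_attraction:
  "attraction g' x y + attraction g' y x = (interaction_G g' x y * (1 - x \<bullet> y)) *\<^sub>R (x + y)"
proof -
  have "interaction_G g' y x = interaction_G g' x y"
    by (auto simp: interaction_G_def sphere_dist_def inner_commute)
  then show ?thesis
    by (simp add: attraction_def inner_commute[of y x] algebra_simps)
qed

lemma measurable_sphere_dist:
  fixes D :: "'a::euclidean_space set"
  assumes "D \<subseteq> sphere 0 1"
  shows "(\<lambda>p. sphere_dist (fst p) (snd p)) \<in> borel_measurable (borel_on D \<Otimes>\<^sub>M borel_on D)"
proof -
  have id: "(\<lambda>x. x) \<in> borel_on D \<rightarrow>\<^sub>M borel"
    unfolding borel_on_def by (intro measurable_restrict_space1) simp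
  have [measurable]: "fst \<in> borel_on D \<Otimes>\<^sub>M borel_on D \<rightarrow>\<^sub>M borel" "snd \<in> borel_on D \<Otimes>\<^sub>M borel_on D \<rightarrow>\<^sub>M borel"
    using measurable_compose[OF measurable_fst id] measurable_compose[OF measurable_snd id] by auto
  \<comment> \<open>Clamping the inner product to \<open>[-1, 1]\<close> makes \<open>arccos\<close> continuous on the whole line.\<close>
  have "continuous_on UNIV (\<lambda>u::real. arccos (max (-1) (min 1 u)))"
    by (intro continuous_intros) auto
  then have "(\<lambda>u::real. arccos (max (-1) (min 1 u))) \<in> borel_measurable borel"
    by (rule borel_measurable_continuous_onI)
  then have "(\<lambda>p. arccos (max (-1) (min 1 (fst p \<bullet> snd p)))) \<in> borel_measurable (borel_on D \<Otimes>\<^sub>M borel_on D)"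
    by measurable
  then show ?thesis
  proof (rule measurable_cong[THEN iffD1, rotated])
    fix p assume "p \<in> space (borel_on D \<Otimes>\<^sub>M borel_on D)"
    then have "fst p \<in> sphere 0 1" "snd p \<in> sphere 0 1"
      using assms by (auto simp: space_pair_measure borel_on_def space_restrict_space)
    from inner_unit_range[OF this]
    show "arccos (max (-1) (min 1 (fst p \<bullet> snd p))) = sphere_dist (fst p) (snd p)"
      by (simp add: sphere_dist_def)
  qed
qed

lemma measurable_attraction:
  fixes D :: "'a::euclidean_space set"
  assumes D: "D \<subseteq> sphere 0 1" and g': "continuous_on {0..} g'"
  shows "case_prod (attraction g') \<in> borel_measurable (borel_on D \<Otimes>\<^sub>M borel_on D)"
proof -
  have id: "(\<lambda>x. x) \<in> borel_on D \<rightarrow>\<^sub>M borel"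
    unfolding borel_on_def by (intro measurable_restrict_space1) simp
  have [measurable]: "fst \<in> borel_on D \<Otimes>\<^sub>M borel_on D \<rightarrow>\<^sub>M borel" "snd \<in> borel_on D \<Otimes>\<^sub>M borel_on D \<rightarrow>\<^sub>M borel"
    using measurable_compose[OF measurable_fst id] measurable_compose[OF measurable_snd id] by auto
  note measurable_sphere_dist[OF D, measurable]
  have "continuous_on UNIV (\<lambda>s. g' (s\<^sup>2))"
    by (intro continuous_on_compose2[OF g'] continuous_intros) auto
  then have [measurable]: "(\<lambda>s. g' (s\<^sup>2)) \<in> borel_measurable borel"
    by (rule borel_measurable_continuous_onI)
  have [measurable]: "(\<lambda>p. g' ((sphere_dist (fst p) (snd p))\<^sup>2)) \<in> borel_measurable (borel_on D \<Otimes>\<^sub>M borel_on D)"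
    by (rule measurable_compose[OF measurable_sphere_dist[OF D]]) simp
  show ?thesis
    unfolding attraction_def interaction_G_def case_prod_beta' by measurable
qed

section \<open>The velocity of the mean\<close>

lemma double_integral_symmetrize:
  fixes w :: "'a \<Rightarrow> 'a \<Rightarrow> 'b::euclidean_space"
  assumes "prob_space M"
    and meas: "case_prod w \<in> borel_measurable (M \<Otimes>\<^sub>M M)"
    and bound: "\<And>x y. x \<in> space M \<Longrightarrow> y \<in> space M \<Longrightarrow> norm (w x y) \<le> B"
  shows "integrable (M \<Otimes>\<^sub>M M) (\<lambda>(x, y). w x y + w y x)"
    and "(\<integral>(x, y). w x y + w y x \<partial>(M \<Otimes>\<^sub>M M)) = 2 *\<^sub>R (\<integral>x. \<integral>y. w x y \<partial>M \<partial>M)"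
proof -
  interpret prob_space M by fact
  interpret P: pair_prob_space M M ..
  have int: "integrable (M \<Otimes>\<^sub>M M) (case_prod w)"
    using bound by (intro P.integrable_const_bound[where B = B] AE_I2 meas) (auto simp: space_pair_measure)
  have int': "integrable (M \<Otimes>\<^sub>M M) (\<lambda>(x, y). w y x)"
    using P.integrable_product_swap[OF int] by simp
  have eq': "(\<integral>(x, y). w y x \<partial>(M \<Otimes>\<^sub>M M)) = (\<integral>x. \<integral>y. w x y \<partial>M \<partial>M)"
    using P.integral_product_swap[OF meas] unfolding P.integral_fst[OF int] by simp
  show "integrable (M \<Otimes>\<^sub>M M) (\<lambda>(x, y). w x y + w y x)"
    using Bochner_Integration.integrable_add[OF int int'] by (simp add: case_prod_beta')
  show "(\<integral>(x, y). w x y + w y x \<partial>(M \<Otimes>\<^sub>M M)) = 2 *\<^sub>R (\<integral>x. \<integral>y. w x y \<partial>M \<partial>M)"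
    using Bochner_Integration.integral_add[OF int int']
    unfolding eq' P.integral_fst[OF int, symmetric] by (simp add: case_prod_beta' scaleR_2)
qed

lemma double_integral_inner:
  fixes M :: "'a::euclidean_space measure"
  assumes "prob_space M" and int: "integrable M (\<lambda>x. x)"
    and sub: "space M \<subseteq> sphere 0 1" and meas: "(\<lambda>x. x) \<in> borel_measurable M"
  shows "integrable (M \<Otimes>\<^sub>M M) (\<lambda>(x, y). x \<bullet> y)"
    and "(\<integral>(x, y). x \<bullet> y \<partial>(M \<Otimes>\<^sub>M M)) = (\<integral>x. x \<partial>M) \<bullet> (\<integral>x. x \<partial>M)"
proof -
  interpret prob_space M by fact
  interpret P: pair_prob_space M M ..
  have [measurable]: "fst \<in> M \<Otimes>\<^sub>M M \<rightarrow>\<^sub>M borel" "snd \<in> M \<Otimes>\<^sub>M M \<rightarrow>\<^sub>M borel"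
    using measurable_compose[OF measurable_fst meas] measurable_compose[OF measurable_snd meas] by auto
  show *: "integrable (M \<Otimes>\<^sub>M M) (\<lambda>(x, y). x \<bullet> y)"
  proof (rule P.integrable_const_bound[where B = 1])
    show "AE p in M \<Otimes>\<^sub>M M. norm (case p of (x, y) \<Rightarrow> x \<bullet> y) \<le> 1"
    proof (rule AE_I2)
      fix p assume "p \<in> space (M \<Otimes>\<^sub>M M)"
      then have "fst p \<in> sphere 0 1" "snd p \<in> sphere 0 1"
        using sub by (auto simp: space_pair_measure)
      from inner_unit_range[OF this] show "norm (case p of (x, y) \<Rightarrow> x \<bullet> y) \<le> 1"
        by (simp add: case_prod_beta' abs_le_iff)
    qed
    show "(\<lambda>(x, y). x \<bullet> y) \<in> borel_measurable (M \<Otimes>\<^sub>M M)"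
      unfolding case_prod_beta' by measurable
  qed
  show "(\<integral>(x, y). x \<bullet> y \<partial>(M \<Otimes>\<^sub>M M)) = (\<integral>x. x \<partial>M) \<bullet> (\<integral>x. x \<partial>M)"
    unfolding P.integral_fst[OF *, symmetric] using int by simp
qed

text \<open>
  By symmetrization, \<open>2 *\<^sub>R v\<close> is the double integral of vectors \<open>a *\<^sub>R (x + y)\<close> with
  \<open>a \<ge> C * (1 - x \<bullet> y)\<close>. In the cap, \<open>x + y\<close> has length at most 2 and height at least \<open>2 * sin \<epsilon>\<close>.
  This gives the first bound pointwise, and the second one because the double integral of \<open>x \<bullet> y\<close>
  is \<open>m \<bullet> m\<close>.
\<close>

lemma mean_velocity_bounds:
  fixes M :: "((real^'k) \<times> real) measure"
  assumes \<epsilon>: "0 < \<epsilon>" "\<epsilon> < pi / 2"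
    and M: "M \<in> prob_measures (open_cap \<epsilon>)"
    and cont: "continuous_on {0..} g'"
    and bound: "\<And>s. 0 \<le> s \<Longrightarrow> s \<le> pi\<^sup>2 \<Longrightarrow> \<bar>g' s\<bar> \<le> B"
    and C: "0 < C" "\<And>x y :: (real^'k) \<times> real. x \<in> open_cap \<epsilon> \<Longrightarrow> y \<in> open_cap \<epsilon> \<Longrightarrow> C \<le> interaction_G g' x y"
  defines "v \<equiv> \<integral>x. \<integral>y. attraction g' x y \<partial>M \<partial>M" and "m \<equiv> \<integral>x. x \<partial>M"
  shows "norm v \<le> (1 / sin \<epsilon>) * (v \<bullet> north)"
    and "C * sin \<epsilon> * (1 - m \<bullet> m) \<le> v \<bullet> north"
proof -
  have prob: "prob_space M" and sets_M: "sets M = sets (borel_on (open_cap \<epsilon>))"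
    using M by (auto simp: prob_measures_def)
  interpret prob_space M by fact
  interpret P: pair_prob_space M M ..
  have space_M: "space M = open_cap \<epsilon>"
    using sets_eq_imp_space_eq[OF sets_M] by (simp add: borel_on_def space_restrict_space)
  have cap: "(open_cap \<epsilon> :: ((real^'k) \<times> real) set) \<subseteq> sphere 0 1" by (auto simp: open_cap_def)
  have sin_pos: "0 < sin \<epsilon>" using \<epsilon> by (intro sin_gt_zero) auto
  let ?S = "\<lambda>x y. attraction g' x y + attraction g' y x"
  have meas: "case_prod (attraction g') \<in> borel_measurable (M \<Otimes>\<^sub>M M)"
    unfolding measurable_cong_sets[OF sets_pair_measure_cong[OF sets_M sets_M] refl]
    by (rule measurable_attraction[OF cap cont])
  have att: "norm (attraction g' x y) \<le> 2 * B * pi" if "x \<in> space M" "y \<in> space M" for x y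
    using that cap by (intro norm_attraction_le bound) (auto simp: space_M)
  note sym = double_integral_symmetrize[OF prob meas att]
  have v: "(\<integral>p. ?S (fst p) (snd p) \<partial>(M \<Otimes>\<^sub>M M)) = 2 *\<^sub>R v"
    using sym(2) by (simp add: v_def case_prod_beta')
  have int: "integrable (M \<Otimes>\<^sub>M M) (\<lambda>p. ?S (fst p) (snd p))"
    using sym(1) by (simp add: case_prod_beta')
  have v_north: "(\<integral>p. ?S (fst p) (snd p) \<bullet> north \<partial>(M \<Otimes>\<^sub>M M)) = 2 * (v \<bullet> north)"
    using int v by (subst integral_inner_left) auto
  have pointwise: "sin \<epsilon> * norm (?S x y) \<le> ?S x y \<bullet> north"
      "2 * C * sin \<epsilon> * (1 - x \<bullet> y) \<le> ?S x y \<bullet> north"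
    if "x \<in> open_cap \<epsilon>" "y \<in> open_cap \<epsilon>" for x y :: "(real^'k) \<times> real"
  proof -
    have xy: "x \<in> sphere 0 1" "y \<in> sphere 0 1" using that cap by auto
    define a where "a = interaction_G g' x y * (1 - x \<bullet> y)"
    have u: "0 \<le> 1 - x \<bullet> y" using inner_unit_range[OF xy] by simp
    have a: "C * (1 - x \<bullet> y) \<le> a" unfolding a_def by (intro mult_right_mono C that u)
    then have a0: "0 \<le> a" using C u by (meson mult_nonneg_nonneg less_imp_le order_trans)
    have S: "?S x y = a *\<^sub>R (x + y)" by (simp only: symmetrized_attraction a_def)
    have h: "2 * sin \<epsilon> \<le> (x + y) \<bullet> north"
      using height_in_open_cap[OF \<epsilon> that(1)] height_in_open_cap[OF \<epsilon> that(2)]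
      by (simp add: inner_add_left)
    have "norm (x + y) \<le> 2" using norm_triangle_ineq[of x y] xy by simp
    then have "sin \<epsilon> * norm (x + y) \<le> (x + y) \<bullet> north"
      using h mult_left_mono[of "norm (x + y)" 2 "sin \<epsilon>"] sin_pos by linarith
    from mult_left_mono[OF this a0] show "sin \<epsilon> * norm (?S x y) \<le> ?S x y \<bullet> north"
      using a0 by (simp add: S mult_ac)
    have "2 * C * sin \<epsilon> * (1 - x \<bullet> y) = (C * (1 - x \<bullet> y)) * (2 * sin \<epsilon>)" by simp
    also have "\<dots> \<le> a * ((x + y) \<bullet> north)"
      using a h a0 sin_pos by (intro mult_mono) auto
    finally show "2 * C * sin \<epsilon> * (1 - x \<bullet> y) \<le> ?S x y \<bullet> north"
      by (simp add: S)
  qed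
  have "sin \<epsilon> * norm (2 *\<^sub>R v) \<le> sin \<epsilon> * (\<integral>p. norm (?S (fst p) (snd p)) \<partial>(M \<Otimes>\<^sub>M M))"
    unfolding v[symmetric] using sin_pos by (intro mult_left_mono integral_norm_bound) auto
  also have "\<dots> = (\<integral>p. sin \<epsilon> * norm (?S (fst p) (snd p)) \<partial>(M \<Otimes>\<^sub>M M))"
    by simp
  also have "\<dots> \<le> (\<integral>p. ?S (fst p) (snd p) \<bullet> north \<partial>(M \<Otimes>\<^sub>M M))"
    using int pointwise(1) by (intro integral_mono) (auto simp: space_pair_measure space_M)
  finally show "norm v \<le> (1 / sin \<epsilon>) * (v \<bullet> north)"
    unfolding v_north using sin_pos by (simp add: field_simps)
  have id: "(\<lambda>x. x) \<in> borel_measurable M"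
    unfolding measurable_cong_sets[OF sets_M refl] borel_on_def
    by (intro measurable_restrict_space1) simp
  have int_id: "integrable M (\<lambda>x. x)"
    using cap by (intro integrable_const_bound[where B = 1] id AE_I2) (auto simp: space_M)
  have "space M \<subseteq> sphere 0 1" using cap by (simp add: space_M)
  note ip = double_integral_inner[OF prob int_id this id, unfolded case_prod_beta', folded m_def]
  have "2 * C * sin \<epsilon> * (1 - m \<bullet> m) = (\<integral>p. 2 * C * sin \<epsilon> * (1 - fst p \<bullet> snd p) \<partial>(M \<Otimes>\<^sub>M M))"
    using ip P.prob_space by simp
  also have "\<dots> \<le> (\<integral>p. ?S (fst p) (snd p) \<bullet> north \<partial>(M \<Otimes>\<^sub>M M))"
    using int ip(1) pointwise(2) by (intro integral_mono) (auto simp: space_pair_measure space_M)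
  finally show "C * sin \<epsilon> * (1 - m \<bullet> m) \<le> v \<bullet> north"
    unfolding v_north by simp
qed

text \<open>
  Differentiation under the integral by dominated convergence: a bound on the velocity bounds all
  difference quotients.
\<close>

lemma mean_has_vector_derivative:
  fixes \<Psi> :: "real \<Rightarrow> 'a \<Rightarrow> 'b::euclidean_space"
  assumes "finite_measure R"
    and meas: "\<And>t. 0 \<le> t \<Longrightarrow> \<Psi> t \<in> borel_measurable R"
    and meas_V: "\<And>t. 0 \<le> t \<Longrightarrow> V t \<in> borel_measurable R"
    and bound: "\<And>t x. 0 \<le> t \<Longrightarrow> x \<in> space R \<Longrightarrow> norm (\<Psi> t x) \<le> B"
    and bound_V: "\<And>t x. 0 \<le> t \<Longrightarrow> x \<in> space R \<Longrightarrow> norm (V t x) \<le> M"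
    and der: "\<And>t x. 0 \<le> t \<Longrightarrow> x \<in> space R \<Longrightarrow>
      ((\<lambda>s. \<Psi> s x) has_vector_derivative V t x) (at t within {0..})"
    and t: "0 \<le> t"
  shows "((\<lambda>s. \<integral>x. \<Psi> s x \<partial>R) has_vector_derivative (\<integral>x. V t x \<partial>R)) (at t within {0..})"
proof -
  interpret finite_measure R by fact
  \<comment> \<open>The remainder of the first-order expansion at \<open>t\<close>, divided by the size of the time step.\<close>
  define q where "q s x = (1 / norm (s - t)) *\<^sub>R (\<Psi> s x - (\<Psi> t x + (s - t) *\<^sub>R V t x))" for s x
  have int_\<Psi>: "integrable R (\<Psi> s)" if "0 \<le> s" for s
    using that by (intro integrable_const_bound[where B = B] meas AE_I2 bound)
  have int_V: "integrable R (V t)"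
    using t by (intro integrable_const_bound[where B = M] meas_V AE_I2 bound_V)
  have "((\<lambda>s. \<integral>x. q s x \<partial>R) \<longlongrightarrow> 0) (at t within {0..})"
    unfolding tendsto_at_iff_sequentially o_def
  proof (intro allI impI)
    fix X :: "nat \<Rightarrow> real" assume X: "\<forall>i. X i \<in> {0..} - {t}" and lim: "X \<longlonglongrightarrow> t"
    have "(\<lambda>i. \<integral>x. q (X i) x \<partial>R) \<longlonglongrightarrow> (\<integral>x. 0 \<partial>R)"
    proof (rule integral_dominated_convergence[where w = "\<lambda>_. 2 * M"])
      show "q (X i) \<in> borel_measurable R" for i
        unfolding q_def using X t
        by (intro borel_measurable_scaleR borel_measurable_diff borel_measurable_add
            borel_measurable_const meas meas_V) auto
      show "AE x in R. (\<lambda>i. q (X i) x) \<longlonglongrightarrow> 0"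
      proof (rule AE_I2)
        fix x assume "x \<in> space R"
        then have "((\<lambda>s. q s x) \<longlongrightarrow> 0) (at t within {0..})"
          using der[OF t, of x] by (simp add: has_vector_derivative_def has_derivative_within q_def)
        then show "(\<lambda>i. q (X i) x) \<longlonglongrightarrow> 0"
          using X lim by (auto simp: tendsto_at_iff_sequentially o_def)
      qed
      show "AE x in R. norm (q (X i) x) \<le> 2 * M" for i
      proof (rule AE_I2)
        fix x assume x: "x \<in> space R"
        have pos: "0 < norm (X i - t)" and Xi: "0 \<le> X i" using X by auto
        have "norm (\<Psi> (X i) x - \<Psi> t x - (X i - t) *\<^sub>R V t x) \<le> norm (X i - t) * (2 * M)"
        proof (rule vector_differentiable_bound_linearization[where S = "{0..}"])
          show "closed_segment t (X i) \<subseteq> {0..}"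
            using Xi t by (auto simp: closed_segment_eq_real_ivl)
          show "norm (V s x - V t x) \<le> 2 * M" if "s \<in> {0..}" for s
            using norm_triangle_ineq4[of "V s x" "V t x"] bound_V[of s x] bound_V[of t x] that t x by simp
        qed (use der x t in auto)
        then have "norm (X i - t) * norm (q (X i) x) \<le> norm (X i - t) * (2 * M)"
          using pos by (simp add: q_def diff_diff_add)
        then show "norm (q (X i) x) \<le> 2 * M" using pos by (simp only: mult_le_cancel_left_pos)
      qed
    qed simp_all
    then show "(\<lambda>i. \<integral>x. q (X i) x \<partial>R) \<longlonglongrightarrow> 0" by simp
  qed
  moreover have "(\<integral>x. q s x \<partial>R) =
      (1 / norm (s - t)) *\<^sub>R ((\<integral>x. \<Psi> s x \<partial>R) - ((\<integral>x. \<Psi> t x \<partial>R) + (s - t) *\<^sub>R (\<integral>x. V t x \<partial>R)))"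
    if "0 \<le> s" for s
    unfolding q_def using int_\<Psi>[OF that] int_\<Psi>[OF t] int_V by simp
  ultimately show ?thesis
    unfolding has_vector_derivative_def has_derivative_within
    by (auto intro!: bounded_linear_intros elim!: Lim_transform_eventually simp: eventually_at_filter)
qed

section \<open>Curves whose length is controlled by one component\<close>

text \<open>
  If the component along \<open>e\<close> of the velocity controls the whole velocity, then a bound on \<open>m \<bullet> e\<close>
  bounds the length of the curve, so the curve converges. Since \<open>m \<bullet> e\<close> converges as well, the drift
  \<open>c * (1 - m \<bullet> m)\<close> cannot stay away from 0, which places the limit on the unit sphere.
\<close>

lemma mean_converges_to_unit_vector:
  fixes m m' :: "real \<Rightarrow> 'a::euclidean_space"
  assumes der: "\<And>t. 0 \<le> t \<Longrightarrow> (m has_vector_derivative m' t) (at t within {0..})"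
    and norm_m: "\<And>t. 0 \<le> t \<Longrightarrow> norm (m t) \<le> 1"
    and speed: "\<And>t. 0 \<le> t \<Longrightarrow> norm (m' t) \<le> A * (m' t \<bullet> e)"
    and drift: "\<And>t. 0 \<le> t \<Longrightarrow> c * (1 - m t \<bullet> m t) \<le> m' t \<bullet> e"
    and A: "0 < A" and c: "0 < c"
  obtains p where "(m \<longlongrightarrow> p) at_top" "norm p = 1" "m 0 \<bullet> e \<le> p \<bullet> e"
proof -
  define F where "F t = m t \<bullet> e" for t
  have der_F: "(F has_vector_derivative m' t \<bullet> e) (at t within {0..})" if "0 \<le> t" for t
    unfolding F_def has_vector_derivative_def
    by (rule has_derivative_eq_rhs[OF has_derivative_inner_left[OF der[OF that, unfolded has_vector_derivative_def]]])
      (auto simp: fun_eq_iff)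
  have interior: "at t within {0..} = at t" if "0 < t" for t :: real
    using that by (intro at_within_interior) (auto simp: interior_real_atLeast)
  have cont_m: "continuous_on {s..t} m" and cont_F: "continuous_on {s..t} F" if "0 \<le> s" for s t
  proof -
    have "continuous_on {0..} m" "continuous_on {0..} F"
      using der der_F by (auto simp: continuous_on_eq_continuous_within intro: has_vector_derivative_continuous)
    then show "continuous_on {s..t} m" "continuous_on {s..t} F"
      using that by (auto intro: continuous_on_subset)
  qed
  \<comment> \<open>The distance travelled by \<open>m\<close> is paid for by the growth of the bounded quantity \<open>F\<close>.\<close>
  have length_bound: "norm (m t - m s) \<le> A * F t - A * F s" if "0 \<le> s" "s \<le> t" for s t
  proof (cases "s = t")
    case False
    show ?thesis
    proof (rule differentiable_bound_general[where f' = m' and \<phi>' = "\<lambda>t. A * (m' t \<bullet> e)"])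
      fix x assume x: "s < x" "x < t"
      then have "0 < x" using that by simp
      with der[of x] show "(m has_vector_derivative m' x) (at x)"
        by (simp add: interior)
      show "((\<lambda>t. A * F t) has_vector_derivative A * (m' x \<bullet> e)) (at x)"
        using der_F[of x] \<open>0 < x\<close> by (auto simp: interior intro!: derivative_eq_intros)
      show "norm (m' x) \<le> A * (m' x \<bullet> e)" using speed[of x] \<open>0 < x\<close> by simp
    qed (use that False cont_m cont_F in \<open>auto intro!: continuous_intros\<close>)
  qed simp
  have mono: "F s \<le> F t" if "0 \<le> s" "s \<le> t" for s t
  proof -
    have "0 \<le> A * (F t - F s)"
      using order_trans[OF norm_ge_zero length_bound[OF that]] by (simp add: algebra_simps)
    then show ?thesis using A by (simp add: zero_le_mult_iff)
  qed
  have F_le: "F t \<le> norm e" if "0 \<le> t" for t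
    using norm_cauchy_schwarz[of "m t" e] mult_right_mono[OF norm_m[OF that] norm_ge_zero[of e]]
    by (simp add: F_def)
  define L where "L = (SUP t\<in>{0..}. F t)"
  have bdd: "bdd_above (F ` {0..})"
    using F_le by (auto intro!: bdd_aboveI)
  have F_le_L: "F t \<le> L" if "0 \<le> t" for t
    unfolding L_def using that by (intro cSUP_upper bdd) auto
  have lim_F: "(F \<longlongrightarrow> L) at_top"
  proof (rule increasing_tendsto)
    show "\<forall>\<^sub>F t in at_top. F t \<le> L"
      using eventually_ge_at_top[of 0] by (rule eventually_mono) (rule F_le_L)
    fix x assume "x < L"
    then obtain s where s: "0 \<le> s" "x < F s"
      unfolding L_def using less_cSUP_iff[OF _ bdd] by auto
    show "\<forall>\<^sub>F t in at_top. x < F t"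
      using eventually_ge_at_top[of s] by (rule eventually_mono) (use mono s in \<open>force intro: less_le_trans\<close>)
  qed
  have lim_nat: "(\<lambda>n. F (real n)) \<longlonglongrightarrow> L"
    using filterlim_compose[OF lim_F filterlim_real_sequentially] .
  have "Cauchy (\<lambda>n. m (real n))"
  proof (rule metric_CauchyI)
    fix \<delta> :: real assume "0 < \<delta>"
    then have "\<forall>\<^sub>F n in sequentially. L - \<delta> / A < F (real n)"
      using A by (intro order_tendstoD(1)[OF lim_nat]) simp
    then obtain n0 where n0: "\<And>n. n \<ge> n0 \<Longrightarrow> L - \<delta> / A < F (real n)"
      by (auto simp: eventually_sequentially)
    have close: "norm (m (real b) - m (real a)) < \<delta>" if "n0 \<le> a" "a \<le> b" for a b
    proof -
      have "norm (m (real b) - m (real a)) \<le> A * (F b - F a)"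
        using length_bound[of "real a" "real b"] that by (simp add: algebra_simps)
      also have "\<dots> < A * (\<delta> / A)"
        using n0[of a] that F_le_L[of "real b"] A by (intro mult_strict_left_mono) auto
      finally show ?thesis using A by simp
    qed
    show "\<exists>M. \<forall>a\<ge>M. \<forall>b\<ge>M. dist (m (real a)) (m (real b)) < \<delta>"
    proof (intro exI[of _ n0] allI impI)
      fix a b assume "n0 \<le> a" "n0 \<le> b"
      then show "dist (m (real a)) (m (real b)) < \<delta>"
        using close[of a b] close[of b a] by (cases "a \<le> b") (auto simp: dist_norm norm_minus_commute)
    qed
  qed
  then obtain p where p: "(\<lambda>n. m (real n)) \<longlonglongrightarrow> p"
    using Cauchy_convergent_iff convergent_def by blast
  have dist_p: "norm (m t - p) \<le> A * L - A * F t" if "0 \<le> t" for t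
  proof (rule tendsto_le[OF sequentially_bot])
    show "(\<lambda>n. A * F (real n) - A * F t) \<longlonglongrightarrow> A * L - A * F t"
      by (intro tendsto_intros lim_nat)
    show "(\<lambda>n. norm (m t - m (real n))) \<longlonglongrightarrow> norm (m t - p)"
      by (intro tendsto_intros p)
    show "\<forall>\<^sub>F n in sequentially. norm (m t - m (real n)) \<le> A * F (real n) - A * F t"
      using eventually_ge_at_top[of "nat \<lceil>t\<rceil>"]
    proof eventually_elim
      case (elim n)
      then have "t \<le> real n" by linarith
      then show ?case using length_bound[of t "real n"] that by (simp add: norm_minus_commute)
    qed
  qed
  have lim_m: "(m \<longlongrightarrow> p) at_top"
  proof (rule Lim_null[THEN iffD2], rule Lim_null_comparison)
    show "\<forall>\<^sub>F t in at_top. norm (m t - p) \<le> A * L - A * F t"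
      using eventually_ge_at_top[of 0] by (rule eventually_mono) (rule dist_p)
    show "((\<lambda>t. A * L - A * F t) \<longlongrightarrow> 0) at_top"
      using tendsto_diff[OF tendsto_const tendsto_mult_left[OF lim_F], of "A * L" A] by simp
  qed
  have "p \<bullet> e = L"
    using tendsto_unique[OF _ tendsto_inner[OF lim_m tendsto_const] lim_F[unfolded F_def]] by simp
  then have "m 0 \<bullet> e \<le> p \<bullet> e"
    using F_le_L[of 0] by (simp add: F_def)
  moreover have "norm p = 1"
  proof (rule ccontr)
    assume "norm p \<noteq> 1"
    moreover have "norm p \<le> 1"
      by (rule tendsto_upperbound[OF tendsto_norm[OF lim_m] eventually_mono[OF eventually_ge_at_top[of 0]]])
        (auto intro: norm_m)
    ultimately have "p \<bullet> p < 1"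
      by (simp add: dot_square_norm power_less_one_iff)
    \<comment> \<open>If the limit were inside the ball, \<open>F\<close> would eventually grow by \<open>c * \<eta>\<close> in each unit of time,
      which contradicts its convergence.\<close>
    define \<eta> where "\<eta> = (1 - p \<bullet> p) / 2"
    have \<eta>: "0 < \<eta>" using \<open>p \<bullet> p < 1\<close> by (simp add: \<eta>_def)
    have "((\<lambda>t. 1 - m t \<bullet> m t) \<longlongrightarrow> 1 - p \<bullet> p) at_top"
      by (intro tendsto_intros lim_m)
    then have "\<forall>\<^sub>F t in at_top. \<eta> < 1 - m t \<bullet> m t"
      by (rule order_tendstoD) (use \<eta> in \<open>simp add: \<eta>_def field_simps\<close>)
    then obtain T0 where T0: "\<And>t. t \<ge> T0 \<Longrightarrow> \<eta> < 1 - m t \<bullet> m t"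
      by (auto simp: eventually_at_top_linorder)
    define T where "T = max T0 0"
    have growth: "c * \<eta> \<le> F (t + 1) - F t" if "T \<le> t" for t
    proof -
      have t: "0 \<le> t" "T0 \<le> t" using that by (auto simp: T_def)
      have "norm (c * \<eta> * (t + 1) - c * \<eta> * t) \<le> F (t + 1) - F t"
      proof (rule differentiable_bound_general[where f' = "\<lambda>_. c * \<eta>" and \<phi>' = "\<lambda>t. m' t \<bullet> e"])
        fix x assume x: "t < x" "x < t + 1"
        then have "0 < x" using t by simp
        with der_F[of x] show "(F has_vector_derivative m' x \<bullet> e) (at x)"
          by (simp add: interior)
        show "((*) (c * \<eta>) has_vector_derivative c * \<eta>) (at x)"
          by (auto intro!: derivative_eq_intros)
        have "c * \<eta> \<le> c * (1 - m x \<bullet> m x)"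
          using T0[of x] x t c by (intro mult_left_mono) auto
        also have "\<dots> \<le> m' x \<bullet> e" using drift[of x] \<open>0 < x\<close> by simp
        finally show "norm (c * \<eta>) \<le> m' x \<bullet> e" using c \<eta> by simp
      qed (use t cont_F in \<open>auto intro!: continuous_intros\<close>)
      then show ?thesis by (simp add: algebra_simps)
    qed
    have "((\<lambda>t. F (t + 1) - F t) \<longlongrightarrow> L - L) at_top"
    proof (intro tendsto_diff lim_F filterlim_compose[OF lim_F])
      show "filterlim (\<lambda>t::real. t + 1) at_top at_top" by real_asymp
    qed
    then have "c * \<eta> \<le> L - L"
      by (rule tendsto_lowerbound[OF _ eventually_mono[OF eventually_ge_at_top[of T] growth]])
        (assumption | rule trivial_limit_at_top_linorder)+
    then show False using c \<eta> by (simp add: mult_le_0_iff)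
  qed
  ultimately show ?thesis using that lim_m by blast
qed

section \<open>Transport distance to a point mass\<close>

lemma W1_return_le:
  fixes D :: "'a::euclidean_space set"
  assumes D: "D \<subseteq> sphere 0 1" and \<mu>: "\<mu> \<in> prob_measures D" and p: "p \<in> D"
  shows "W1 \<mu> (return (borel_on D) p) \<le> (\<integral>\<^sup>+ x. ennreal (sphere_dist x p) \<partial>\<mu>)"
proof -
  let ?\<nu> = "return (borel_on D) p"
  have prob: "prob_space \<mu>" and sets_\<mu>: "sets \<mu> = sets (borel_on D)"
    using \<mu> by (auto simp: prob_measures_def)
  interpret prob_space \<mu> by fact
  have p_space: "p \<in> space (borel_on D)" using p by (simp add: borel_on_def space_restrict_space)
  have pair: "(\<lambda>x. (x, p)) \<in> \<mu> \<rightarrow>\<^sub>M \<mu> \<Otimes>\<^sub>M ?\<nu>"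
    using p_space by (intro measurable_Pair) auto
  \<comment> \<open>The product coupling, in which all the mass is sent to \<open>p\<close>.\<close>
  define \<pi> where "\<pi> = distr \<mu> (\<mu> \<Otimes>\<^sub>M ?\<nu>) (\<lambda>x. (x, p))"
  have "distr \<pi> \<mu> fst = \<mu>"
    unfolding \<pi>_def using pair by (subst distr_distr) (auto simp: o_def distr_id2)
  moreover have "distr \<pi> ?\<nu> snd = ?\<nu>"
  proof -
    have "distr \<pi> ?\<nu> snd = distr \<mu> ?\<nu> (\<lambda>x. p)"
      unfolding \<pi>_def distr_distr[OF measurable_snd pair] by (simp add: o_def)
    also have "\<dots> = distr \<mu> (borel_on D) (\<lambda>x. p)"
      by (rule distr_cong[OF refl sets_return refl])
    also have "\<dots> = ?\<nu>" by (rule distr_const[OF p_space])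
    finally show ?thesis .
  qed
  moreover have "prob_space \<pi>" "sets \<pi> = sets (\<mu> \<Otimes>\<^sub>M ?\<nu>)"
    unfolding \<pi>_def by (rule prob_space_distr[OF pair], rule sets_distr)
  ultimately have "\<pi> \<in> couplings \<mu> ?\<nu>"
    unfolding couplings_def by blast
  then have "W1 \<mu> ?\<nu> \<le> (\<integral>\<^sup>+ q. ennreal (sphere_dist (fst q) (snd q)) \<partial>\<pi>)"
    unfolding W1_def by (rule INF_lower)
  also have "\<dots> = (\<integral>\<^sup>+ x. ennreal (sphere_dist x p) \<partial>\<mu>)"
  proof -
    have "(\<lambda>q. sphere_dist (fst q) (snd q)) \<in> borel_measurable (\<mu> \<Otimes>\<^sub>M ?\<nu>)"
      unfolding measurable_cong_sets[OF sets_pair_measure_cong[OF sets_\<mu> sets_return] refl]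
      by (rule measurable_sphere_dist[OF D])
    then show ?thesis
      unfolding \<pi>_def by (subst nn_integral_distr[OF pair]) simp_all
  qed
  finally show ?thesis .
qed

text \<open>
  A distance is at most \<open>\<delta>\<close> unless \<open>1 - u\<close> exceeds \<open>1 - cos \<delta>\<close>, and it never exceeds \<open>pi\<close>. An affine
  bound is what is wanted, since integrating it brings in only the mean of a measure.
\<close>

lemma arccos_le_affine:
  assumes "-1 \<le> u" "u \<le> 1" "0 < \<delta>" "\<delta> \<le> pi"
  shows "arccos u \<le> \<delta> + pi / (1 - cos \<delta>) * (1 - u)"
proof -
  have cos: "cos \<delta> < 1" using cos_monotone_0_pi[of 0 \<delta>] assms by simp
  show ?thesis
  proof (cases "cos \<delta> \<le> u")
    case True
    have "arccos u \<le> arccos (cos \<delta>)" using True assms by (intro arccos_le_arccos) auto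
    moreover have "0 \<le> pi / (1 - cos \<delta>) * (1 - u)" using cos assms by simp
    ultimately show ?thesis using assms arccos_cos[of \<delta>] by linarith
  next
    case False
    have "pi \<le> pi / (1 - cos \<delta>) * (1 - u)"
      using cos False by (simp add: pos_le_divide_eq)
    then show ?thesis using arccos_ubound[of u] assms by linarith
  qed
qed

text \<open>
  This is how the mean controls the transport distance: a probability measure on the sphere whose mean
  is close to the unit vector \<open>p\<close> has little mass away from \<open>p\<close>.
\<close>

lemma W1_return_le_mean:
  fixes D :: "'a::euclidean_space set"
  assumes D: "D \<subseteq> sphere 0 1" and \<mu>: "\<mu> \<in> prob_measures D" and p: "p \<in> D"
    and \<delta>: "0 < \<delta>" "\<delta> \<le> pi"
  shows "W1 \<mu> (return (borel_on D) p) \<le> ennreal (\<delta> + pi / (1 - cos \<delta>) * (1 - (\<integral>x. x \<partial>\<mu>) \<bullet> p))"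
proof -
  have prob: "prob_space \<mu>" and sets_\<mu>: "sets \<mu> = sets (borel_on D)"
    using \<mu> by (auto simp: prob_measures_def)
  interpret prob_space \<mu> by fact
  have space_\<mu>: "space \<mu> = D"
    using sets_eq_imp_space_eq[OF sets_\<mu>] by (simp add: borel_on_def space_restrict_space)
  have id: "(\<lambda>x. x) \<in> borel_measurable \<mu>"
    unfolding measurable_cong_sets[OF sets_\<mu> refl] borel_on_def
    by (intro measurable_restrict_space1) simp
  have int: "integrable \<mu> (\<lambda>x. x)"
    using D by (intro integrable_const_bound[where B = 1] id AE_I2) (auto simp: space_\<mu>)
  let ?f = "\<lambda>x. \<delta> + pi / (1 - cos \<delta>) * (1 - x \<bullet> p)"
  have f: "sphere_dist x p \<le> ?f x" "0 \<le> ?f x" if "x \<in> D" for x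
  proof -
    have "x \<in> sphere 0 1" "p \<in> sphere 0 1" using that p D by (metis subsetD)+
    note xp = inner_unit_range[OF this]
    show "sphere_dist x p \<le> ?f x"
      unfolding sphere_dist_def by (rule arccos_le_affine[OF xp \<delta>])
    with arccos_lbound[OF xp] show "0 \<le> ?f x" by (simp add: sphere_dist_def)
  qed
  have int_f: "integrable \<mu> ?f" using int by simp
  have "W1 \<mu> (return (borel_on D) p) \<le> (\<integral>\<^sup>+ x. ennreal (sphere_dist x p) \<partial>\<mu>)"
    by (rule W1_return_le[OF D \<mu> p])
  also have "\<dots> \<le> (\<integral>\<^sup>+ x. ennreal (?f x) \<partial>\<mu>)"
    using f by (intro nn_integral_mono ennreal_leI) (simp add: space_\<mu>)
  also have "\<dots> = ennreal (\<integral>x. ?f x \<partial>\<mu>)"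
    using f by (intro nn_integral_eq_integral int_f AE_I2) (simp add: space_\<mu>)
  also have "(\<integral>x. ?f x \<partial>\<mu>) = \<delta> + pi / (1 - cos \<delta>) * (1 - (\<integral>x. x \<partial>\<mu>) \<bullet> p)"
    using int prob_space by simp
  finally show ?thesis .
qed

section \<open>Convergence to consensus\<close>

theorem theorem4p12:
  fixes \<epsilon> r C :: real
    and K :: "(real^'k) \<times> real \<Rightarrow> (real^'k) \<times> real \<Rightarrow> real"
    and g g' :: "real \<Rightarrow> real"
    and \<rho>\<^sub>0 :: "((real^'k) \<times> real) measure"
    and \<rho> :: "real \<Rightarrow> ((real^'k) \<times> real) measure"
  assumes "0 < \<epsilon>" and "\<epsilon> < pi / 2"
    and "0 < r" and "r < pi / 2 - \<epsilon>"
    and "\<And>x y. x \<in> sphere 0 1 \<Longrightarrow> y \<in> sphere 0 1 \<Longrightarrow> K x y = g ((sphere_dist x y)\<^sup>2)"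
    and "\<And>s. 0 \<le> s \<Longrightarrow> (g has_real_derivative g' s) (at s within {0..})"
    and "\<And>s. 0 \<le> s \<Longrightarrow> \<exists>u>0. \<exists>L. L-lipschitz_on (cball s u \<inter> {0..}) g'"
    and "\<And>s. 0 \<le> s \<Longrightarrow> 0 \<le> g' s"
    and "\<exists>g''. continuous_on {0..4 * r\<^sup>2} g'' \<and>
           (\<forall>s\<in>{0..4 * r\<^sup>2}. (g' has_real_derivative g'' s) (at s within {0..4 * r\<^sup>2}))"
    and "0 < C"
    and "\<And>(x :: (real^'k) \<times> real) (y :: (real^'k) \<times> real).
           x \<in> open_cap \<epsilon> \<Longrightarrow> y \<in> open_cap \<epsilon> \<Longrightarrow> C \<le> interaction_G g' x y"
    and "\<And>(x\<^sub>1 :: (real^'k) \<times> real) (y\<^sub>1 :: (real^'k) \<times> real) (x\<^sub>2 :: (real^'k) \<times> real)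
            (y\<^sub>2 :: (real^'k) \<times> real).
           x\<^sub>1 \<in> open_cap \<epsilon> \<Longrightarrow> y\<^sub>1 \<in> open_cap \<epsilon> \<Longrightarrow> x\<^sub>2 \<in> open_cap \<epsilon> \<Longrightarrow> y\<^sub>2 \<in> open_cap \<epsilon> \<Longrightarrow>
           sphere_dist x\<^sub>1 y\<^sub>1 \<ge> sphere_dist x\<^sub>2 y\<^sub>2 \<Longrightarrow>
           interaction_G g' x\<^sub>1 y\<^sub>1 \<ge> interaction_G g' x\<^sub>2 y\<^sub>2"
    and "\<rho>\<^sub>0 \<in> prob_measures (open_cap \<epsilon>)" and "supp \<rho>\<^sub>0 \<subseteq> closed_cap r"
    and "narrowly_continuous_on (open_cap \<epsilon>) {0..} \<rho>"
    and "weak_solution (open_cap \<epsilon>) K \<infinity> \<rho>"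
    and "\<rho> 0 = \<rho>\<^sub>0"
  shows "\<exists>p \<in> closed_cap r.
           ((\<lambda>t. W1 (\<rho> t) (return (borel_on (open_cap \<epsilon>)) p)) \<longlongrightarrow> 0) at_top"
proof -
  note \<epsilon> = assms(1,2) and r = assms(3,4) and K = assms(5) and g = assms(6) and lip = assms(7)
    and C = assms(10,11) and supp0 = assms(14) and weak = assms(16) and init = assms(17)
  let ?D = "open_cap \<epsilon> :: ((real^'k) \<times> real) set"
  have cap: "?D \<subseteq> sphere 0 1" by (auto simp: open_cap_def)
  have sin_pos: "0 < sin \<epsilon>" using \<epsilon> by (intro sin_gt_zero) auto
  have time: "time_interval \<infinity> = {0..}" by (auto simp: time_interval_def)
  have \<rho>: "\<rho> t \<in> prob_measures ?D" if "0 \<le> t" for t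
    using weak that unfolding weak_solution_def time by simp
  define R where "R = restrict_space (\<rho> 0) (supp (\<rho> 0))"
  from weak obtain \<Psi> where unique: "unique_flow_map ?D (velocity K \<rho>) (supp (\<rho> 0)) \<infinity> \<Psi>"
    and pushed: "\<forall>t\<in>{0..}. \<Psi> t \<in> R \<rightarrow>\<^sub>M borel_on ?D \<and> \<rho> t = distr R (borel_on ?D) (\<Psi> t)"
    unfolding weak_solution_def time R_def by (elim conjE exE)
  have flow: "flow_map ?D (velocity K \<rho>) (supp (\<rho> 0)) \<infinity> \<Psi>"
    and \<Psi>_meas: "\<And>t. 0 \<le> t \<Longrightarrow> \<Psi> t \<in> R \<rightarrow>\<^sub>M borel_on ?D"
    and push: "\<And>t. 0 \<le> t \<Longrightarrow> \<rho> t = distr R (borel_on ?D) (\<Psi> t)"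
    using unique pushed unfolding unique_flow_map_def by simp_all
  have space_R: "x \<in> supp (\<rho> 0)" if "x \<in> space R" for x
    using that by (simp add: R_def space_restrict_space)
  have \<Psi>_0: "\<Psi> 0 x = x" if "x \<in> space R" for x
    using flow space_R[OF that] by (simp add: flow_map_def)
  have \<Psi>_D: "\<Psi> t x \<in> ?D" if "x \<in> space R" "0 \<le> t" for x t
    using flow space_R[OF that(1)] that(2) by (simp add: flow_map_def time)
  have \<Psi>_der: "((\<lambda>s. \<Psi> s x) has_vector_derivative velocity K \<rho> (\<Psi> t x) t) (at t within {0..})"
    if "x \<in> space R" "0 \<le> t" for x t
    using flow space_R[OF that(1)] that(2) by (simp add: flow_map_def time)
  have sets_\<rho>: "sets (\<rho> t) = sets (borel_on ?D)" and prob_\<rho>: "prob_space (\<rho> t)" if "0 \<le> t" for t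
    using \<rho>[OF that] by (auto simp: prob_measures_def)
  have space_\<rho>: "space (\<rho> t) = ?D" if "0 \<le> t" for t
    using sets_eq_imp_space_eq[OF sets_\<rho>[OF that]] by (simp add: borel_on_def space_restrict_space)
  \<comment> \<open>No mass of \<open>\<rho> 0\<close> is lost in the restriction to the support, because the push-forward of the
    restriction is a probability measure.\<close>
  have prob_R: "prob_space R"
    using prob_\<rho>[of 0] push[of 0] prob_space_distrD[OF \<Psi>_meas[of 0]] by simp
  interpret R: prob_space R by fact
  have transfer: "(\<integral>x. f x \<partial>\<rho> t) = (\<integral>x. f (\<Psi> t x) \<partial>R)"
    if "0 \<le> t" "f \<in> borel_measurable (borel_on ?D)" for t and f :: "(real^'k) \<times> real \<Rightarrow> (real^'k) \<times> real"
    unfolding push[OF that(1)] by (rule integral_distr[OF \<Psi>_meas[OF that(1)] that(2)])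

  have cont_g': "continuous_on {0..} g'"
    unfolding continuous_on_eq_continuous_within
  proof
    fix s :: real assume "s \<in> {0..}"
    then obtain u L where u: "0 < u" and L: "L-lipschitz_on (cball s u \<inter> {0..}) g'"
      using lip[of s] by auto
    have "continuous (at s within cball s u \<inter> {0..}) g'"
      using lipschitz_on_continuous_on[OF L] u \<open>s \<in> {0..}\<close>
      by (auto simp: continuous_on_eq_continuous_within)
    moreover have "at s within cball s u \<inter> {0..} = at s within {0..}"
      using u by (intro at_within_nhd[of s "ball s u"]) auto
    ultimately show "continuous (at s within {0..}) g'" by (simp add: continuous_within)
  qed
  have "compact (g' ` {0..pi\<^sup>2})"
    by (intro compact_continuous_image continuous_on_subset[OF cont_g']) auto
  then obtain B where B: "\<And>s. 0 \<le> s \<Longrightarrow> s \<le> pi\<^sup>2 \<Longrightarrow> \<bar>g' s\<bar> \<le> B"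
    using compact_imp_bounded by (fastforce simp: bounded_iff)

  have velocity: "velocity K \<rho> x t = (\<integral>y. attraction g' x y \<partial>\<rho> t)" if "x \<in> ?D" "0 \<le> t" for x t
  proof -
    have "sphere_grad (\<lambda>z. K z y) x = - attraction g' x y" if "y \<in> ?D" for y
    proof (rule sphere_grad_interaction[OF _ _ _ _ g])
      show "x \<in> sphere 0 1" "y \<in> sphere 0 1"
        using cap that \<open>x \<in> ?D\<close> by (metis subsetD)+
      then show "K z y = g ((sphere_dist z y)\<^sup>2)" if "z \<in> sphere 0 1" for z
        using K[OF that] by simp
      \<comment> \<open>Both points lie strictly above the equator, so they are not antipodal.\<close>
      have "0 < (x + y) \<bullet> north"
        using height_in_open_cap[OF \<epsilon> that] height_in_open_cap[OF \<epsilon> \<open>x \<in> ?D\<close>] sin_pos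
        by (simp add: inner_add_left)
      then show "x + y \<noteq> 0" by auto
    qed
    then have "(\<integral>y. sphere_grad (\<lambda>z. K z y) x \<partial>\<rho> t) = (\<integral>y. - attraction g' x y \<partial>\<rho> t)"
      by (intro Bochner_Integration.integral_cong) (auto simp: space_\<rho>[OF \<open>0 \<le> t\<close>])
    then show ?thesis by (simp add: velocity_def)
  qed
  define V where "V t x = (\<integral>y. attraction g' x y \<partial>\<rho> t)" for t x
  have V_meas: "V t \<in> borel_measurable (borel_on ?D)" if "0 \<le> t" for t
  proof -
    interpret prob_space "\<rho> t" by (rule prob_\<rho>[OF that])
    have "case_prod (attraction g') \<in> borel_measurable (borel_on ?D \<Otimes>\<^sub>M \<rho> t)"
      unfolding measurable_cong_sets[OF sets_pair_measure_cong[OF refl sets_\<rho>[OF that]] refl]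
      by (rule measurable_attraction[OF cap cont_g'])
    then show ?thesis unfolding V_def by (rule borel_measurable_lebesgue_integral)
  qed
  have V_bound: "norm (V t x) \<le> 2 * B * pi" if "0 \<le> t" "x \<in> ?D" for t x
  proof -
    interpret prob_space "\<rho> t" by (rule prob_\<rho>[OF that(1)])
    have "norm (V t x) \<le> (\<integral>y. norm (attraction g' x y) \<partial>\<rho> t)"
      unfolding V_def by (rule integral_norm_bound)
    also have "\<dots> \<le> (\<integral>y. 2 * B * pi \<partial>\<rho> t)"
    proof (rule integral_mono')
      show "norm (attraction g' x y) \<le> 2 * B * pi" if "y \<in> space (\<rho> t)" for y
        using that \<open>x \<in> ?D\<close> cap space_\<rho>[OF \<open>0 \<le> t\<close>] by (intro norm_attraction_le B) auto
      then show "0 \<le> 2 * B * pi" using B[of 0] by simp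
    qed simp
    also have "\<dots> = 2 * B * pi" using prob_space by simp
    finally show ?thesis .
  qed

  define m where "m t = (\<integral>x. x \<partial>\<rho> t)" for t
  have id_meas: "(\<lambda>x. x) \<in> borel_measurable (borel_on ?D)"
    unfolding borel_on_def by (intro measurable_restrict_space1) simp
  have \<Psi>_borel: "\<Psi> t \<in> borel_measurable R" if "0 \<le> t" for t
    using measurable_compose[OF \<Psi>_meas[OF that] id_meas] by simp
  have norm_\<Psi>: "norm (\<Psi> t x) \<le> 1" if "0 \<le> t" "x \<in> space R" for t x
    using \<Psi>_D[OF that(2,1)] cap by auto
  have m_R: "m t = (\<integral>x. \<Psi> t x \<partial>R)" if "0 \<le> t" for t
    unfolding m_def by (rule transfer[OF that id_meas])
  have int_\<Psi>: "integrable R (\<Psi> t)" if "0 \<le> t" for t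
    using that by (intro R.integrable_const_bound[where B = 1] AE_I2 norm_\<Psi> \<Psi>_borel)
  have m_der: "(m has_vector_derivative (\<integral>x. V t x \<partial>\<rho> t)) (at t within {0..})" if t: "0 \<le> t" for t
  proof -
    have "((\<lambda>s. \<integral>x. \<Psi> s x \<partial>R) has_vector_derivative (\<integral>x. V t (\<Psi> t x) \<partial>R)) (at t within {0..})"
    proof (rule mean_has_vector_derivative[where B = 1 and M = "2 * B * pi" and V = "\<lambda>t x. V t (\<Psi> t x)"])
      show "(\<lambda>x. V t (\<Psi> t x)) \<in> borel_measurable R" if "0 \<le> t" for t
        by (rule measurable_compose[OF \<Psi>_meas[OF that] V_meas[OF that]])
      show "((\<lambda>s. \<Psi> s x) has_vector_derivative V t (\<Psi> t x)) (at t within {0..})"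
        if "0 \<le> t" "x \<in> space R" for t x
        using \<Psi>_der[OF that(2,1)] velocity[OF \<Psi>_D[OF that(2,1)] that(1)] by (simp add: V_def)
    qed (use \<Psi>_borel norm_\<Psi> V_bound \<Psi>_D t R.finite_measure_axioms in auto)
    then have "((\<lambda>s. \<integral>x. \<Psi> s x \<partial>R) has_vector_derivative (\<integral>x. V t x \<partial>\<rho> t)) (at t within {0..})"
      by (simp add: transfer[OF t V_meas[OF t]])
    then show ?thesis
      by (rule has_vector_derivative_transform[rotated 2]) (use t m_R in auto)
  qed
  have m_norm: "norm (m t) \<le> 1" if "0 \<le> t" for t
  proof -
    have "norm (m t) \<le> (\<integral>x. norm (\<Psi> t x) \<partial>R)"
      unfolding m_R[OF that] by (rule integral_norm_bound)
    also have "\<dots> \<le> (\<integral>x. 1 \<partial>R)"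
      by (rule integral_mono') (use norm_\<Psi>[OF that] in auto)
    also have "\<dots> = 1" using R.prob_space by simp
    finally show ?thesis .
  qed
  note mean_bounds = mean_velocity_bounds[OF \<epsilon> \<rho> cont_g' B C, folded m_def V_def]
  have rates: "0 < 1 / sin \<epsilon>" "0 < C * sin \<epsilon>" using sin_pos C(1) by auto
  obtain p where lim: "(m \<longlongrightarrow> p) at_top" and p1: "norm p = 1"
    and height: "m 0 \<bullet> north \<le> p \<bullet> north"
    by (rule mean_converges_to_unit_vector[OF m_der m_norm mean_bounds rates])

  \<comment> \<open>The initial mean has height at least \<open>cos r\<close>, and the height of the mean never decreases.\<close>
  have p_cap: "p \<in> closed_cap r"
  proof -
    have "cos r \<le> \<Psi> 0 x \<bullet> north" if "x \<in> space R" for x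
    proof -
      have "x \<in> closed_cap r" using space_R[OF that] supp0 init by auto
      moreover have "x \<in> sphere 0 1" using \<Psi>_D[OF that, of 0] \<Psi>_0[OF that] cap by auto
      ultimately show ?thesis
        using closed_cap_iff_height[of r x] r \<Psi>_0[OF that] \<epsilon> by simp
    qed
    then have "(\<integral>x. cos r \<partial>R) \<le> (\<integral>x. \<Psi> 0 x \<bullet> north \<partial>R)"
      by (intro integral_mono) (use int_\<Psi>[of 0] in auto)
    also have "\<dots> = m 0 \<bullet> north" using int_\<Psi>[of 0] m_R[of 0] by simp
    finally have "cos r \<le> p \<bullet> north" using height R.prob_space by simp
    then show ?thesis using closed_cap_iff_height[of r p] p1 r \<epsilon> by simp
  qed
  then have p_D: "p \<in> ?D" using closed_cap_subset_open_cap[OF r(2)] by auto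

  have "((\<lambda>t. W1 (\<rho> t) (return (borel_on ?D) p)) \<longlongrightarrow> 0) at_top"
  proof (rule tendsto_zero_ennreal)
    fix e :: real assume "0 < e"
    define \<delta> where "\<delta> = min (e / 2) 1"
    have \<delta>: "0 < \<delta>" "\<delta> \<le> pi" "\<delta> < e" using \<open>0 < e\<close> pi_gt3 by (auto simp: \<delta>_def)
    have "((\<lambda>t. \<delta> + pi / (1 - cos \<delta>) * (1 - m t \<bullet> p)) \<longlongrightarrow> \<delta> + pi / (1 - cos \<delta>) * (1 - p \<bullet> p)) at_top"
      by (intro tendsto_intros lim)
    moreover have "p \<bullet> p = 1" using p1 by (simp add: norm_eq_1)
    ultimately have "\<forall>\<^sub>F t in at_top. \<delta> + pi / (1 - cos \<delta>) * (1 - m t \<bullet> p) < e"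
      using \<delta>(3) by (intro order_tendstoD(2)) auto
    then show "\<forall>\<^sub>F t in at_top. W1 (\<rho> t) (return (borel_on ?D) p) < ennreal e"
      using eventually_ge_at_top[of 0]
    proof eventually_elim
      case (elim t)
      have "W1 (\<rho> t) (return (borel_on ?D) p) \<le> ennreal (\<delta> + pi / (1 - cos \<delta>) * (1 - m t \<bullet> p))"
        unfolding m_def by (rule W1_return_le_mean[OF cap \<rho>[OF elim(2)] p_D \<delta>(1,2)])
      also have "\<dots> < ennreal e" using elim(1) \<open>0 < e\<close> by (simp add: ennreal_less_iff ennreal_lessI)
      finally show ?case .
    qed
  qed
  then show ?thesis using p_cap by blast
qed

end
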